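(* Let $q$ be an odd prime power. Every Bierbrauer presemifield $\mathbb{B}=(\mathbb{F}_{q^{4m}},+,\star)$, with multiplication $$x\star y=y^{q^n}x+yx^{q^n}-v\,(y^{q^{m+n}}x^{q^{3m}}+y^{q^{3m}}x^{q^{m+n}}),$$ has middle nucleus of order $q^2$ and center of order $q$. Here $m\ge1$ and $0<n<4m$ are integers with $\gcd(m,n)=1$, $\frac{2m}{\gcd(2m,n)}$ odd, $q^m\equiv q^n\equiv1\pmod 4$, and $v=u^{q^m-1}$ with $u$ a primitive element of $\mathbb{F}_{q^{4m}}$.
   Context: A finite semifield $(S,+,\star)$ satisfies all axioms of a skewfield except possibly associativity of multiplication; a presemifield satisfies all axioms of a semifield except possibly existence of a multiplicative identity. The left, middle, right nucleus of a semifield are the sets of elements $a$ (resp. $b$, $c$) with $(a\star b)\star c=a\star(b\star c)$ for all choices of the other two elements; the center is the set of elements in all three nuclei commuting multiplicatively with every element. Presemifields $(S,+,\star)$, $(S',+,\star')$ of characteristic $p$ are isotopic if there are invertible $\mathbb{F}_p$-linear maps $g_1,g_2,g_3:S\to S'$ with $g_1(x)\star' g_2(y)=g_3(x\star y)$ for all $x,y$. Every presemifield is isotopic to a semifield, and the orders of nuclei and center are isotopy invariants of semifields; the orders of the nuclei and center of a presemifield are by definition those of any semifield isotopic to it. Under the stated conditions the multiplication is known to define a commutative presemifield (a Bierbrauer presemifield). *)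

theory Defs
  imports "HOL-Number_Theory.Number_Theory" "HOL-Library.Cardinality"
begin

text \<open>
  A (pre)semifield has a whole type as its underlying additive group; only its multiplication
  is a parameter. The nonzero elements of a skewfield form a group under multiplication, so
  without associativity they form a loop (semifield), and without an identity a quasigroup
  (presemifield). This is what the two division axioms say; they also cover the right-hand
  side 0, so that there are no zero divisors.
\<close>

locale presemifield =
  fixes mult :: "'a::{ab_group_add,finite} \<Rightarrow> 'a \<Rightarrow> 'a"  (infixl \<open>\<star>\<close> 70)
  assumes nontrivial: "\<exists>x::'a. x \<noteq> 0"
    and distrib_left: "x \<star> (y + z) = x \<star> y + x \<star> z"
    and distrib_right: "(x + y) \<star> z = x \<star> z + y \<star> z"
    and left_division: "a \<noteq> 0 \<Longrightarrow> \<exists>!x. a \<star> x = b"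
    and right_division: "a \<noteq> 0 \<Longrightarrow> \<exists>!x. x \<star> a = b"

locale semifield = presemifield +
  assumes identity: "\<exists>e. \<forall>x. e \<star> x = x \<and> x \<star> e = x"

definition left_nucleus :: "('a \<Rightarrow> 'a \<Rightarrow> 'a) \<Rightarrow> 'a set" where
  "left_nucleus f = {a. \<forall>b c. f (f a b) c = f a (f b c)}"

definition middle_nucleus :: "('a \<Rightarrow> 'a \<Rightarrow> 'a) \<Rightarrow> 'a set" where
  "middle_nucleus f = {b. \<forall>a c. f (f a b) c = f a (f b c)}"

definition right_nucleus :: "('a \<Rightarrow> 'a \<Rightarrow> 'a) \<Rightarrow> 'a set" where
  "right_nucleus f = {c. \<forall>a b. f (f a b) c = f a (f b c)}"

definition center :: "('a \<Rightarrow> 'a \<Rightarrow> 'a) \<Rightarrow> 'a set" where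
  "center f = {z \<in> left_nucleus f \<inter> middle_nucleus f \<inter> right_nucleus f. \<forall>x. f z x = f x z}"

text \<open>
  The additive group of a finite (pre)semifield is elementary abelian of exponent \<open>p\<close>, its
  characteristic, and the scalar action of the prime field is repeated addition. Hence the
  linear maps over the prime field are exactly the additive ones; an additive bijection can
  only exist between structures of the same characteristic.
\<close>

definition isotopic ::
  "('a::ab_group_add \<Rightarrow> 'a \<Rightarrow> 'a) \<Rightarrow> ('b::ab_group_add \<Rightarrow> 'b \<Rightarrow> 'b) \<Rightarrow> bool" where
  "isotopic f f' \<longleftrightarrow> (\<exists>g\<^sub>1 g\<^sub>2 g\<^sub>3 :: 'a \<Rightarrow> 'b.
     additive g\<^sub>1 \<and> bij g\<^sub>1 \<and> additive g\<^sub>2 \<and> bij g\<^sub>2 \<and> additive g\<^sub>3 \<and> bij g\<^sub>3 \<and>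
     (\<forall>x y. f' (g\<^sub>1 x) (g\<^sub>2 y) = g\<^sub>3 (f x y)))"

definition primitive_element :: "'a::finite_field \<Rightarrow> bool" where
  "primitive_element u \<longleftrightarrow> range (\<lambda>k::nat. u ^ k) = - {0}"

definition bierbrauer_mult ::
  "nat \<Rightarrow> nat \<Rightarrow> nat \<Rightarrow> 'a::finite_field \<Rightarrow> 'a \<Rightarrow> 'a \<Rightarrow> 'a" where
  "bierbrauer_mult q m n v x y =
     y ^ (q ^ n) * x + y * x ^ (q ^ n)
     - v * (y ^ (q ^ (m + n)) * x ^ (q ^ (3 * m)) + y ^ (q ^ (3 * m)) * x ^ (q ^ (m + n)))"

end

theory Submission
  imports Defs
begin

text \<open>
  Write \<open>\<sigma>\<close> and \<open>\<tau>\<close> for the automorphisms raising to the powers \<open>q\<^sup>n\<close> and \<open>q\<^sup>m\<close>, and a bar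
  for the involution \<open>\<tau>\<^sup>2\<close>, whose fixed field \<open>L\<close> has order \<open>q\<close> to the power \<open>2m\<close>. With
  \<open>P = \<sigma>(y)x + y\<sigma>(x)\<close> and \<open>Q = \<sigma>(y)bar(x) + bar(y)\<sigma>(x)\<close> the product is \<open>P - v\<tau>(Q)\<close>, and
  \<open>vu = \<tau>(u)\<close>. The arithmetic hypotheses force \<open>n\<close> to be even and \<open>m\<close> to be odd.

  \<^emph>\<open>No zero divisors.\<close> If the product vanishes then \<open>uP = \<tau>(uQ)\<close>. Taking norms to \<open>L\<close> and using
  \<open>N(P) - N(Q) = - t\<sigma>(t)\<close> for \<open>t = bar(y)x - y bar(x)\<close> (\<open>norm_P_minus_norm_Q\<close>), one finds that
  \<open>N(u)t\<sigma>(t)\<close> is negated by \<open>\<tau>\<close>. The quadratic character of \<open>L\<close> is \<open>-1\<close> on nonzero elements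
  negated by \<open>\<tau>\<close>, on \<open>N(u)\<close>, and on \<open>t\<sigma>(t)\<close> for nonzero \<open>t\<close> negated by the bar (here the congruences
  modulo 4 enter). The signs do not match, so \<open>t = 0\<close>, that is, \<open>x/y\<close> lies in \<open>L\<close>.
  Then \<open>N(u)N(Q)\<close> is fixed by \<open>\<tau>\<close>, hence a square in \<open>L\<close>, whereas \<open>N(Q)\<close> is a nonzero square and
  \<open>N(u)\<close> is not a square (\<open>no_zero_divisors\<close>).

  \<^emph>\<open>Isotopy-invariant nuclei.\<close> The middle nucleus of a semifield corresponds to the pairs of maps
  \<open>(\<alpha>, \<beta>)\<close> with \<open>\<alpha>(x)y = x\<beta>(y)\<close>, and its center to the triples with
  \<open>\<alpha>(x)y = x\<beta>(y) = \<gamma>(xy)\<close>. Isotopisms transport such maps by conjugation, so it suffices to count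
  them for the given presemifield.

  \<^emph>\<open>The pairs.\<close> In \<open>\<alpha>(x)y = x\<beta>(y)\<close> the left side is, as a function of \<open>y\<close>, a combination of the
  four powers \<open>1, \<sigma>, \<tau>\<^sup>3, \<tau>\<sigma>\<close> of the Frobenius map. Since distinct automorphisms are linearly
  independent even modulo a subspace (\<open>dedekind_independence_mod_subspace\<close>), comparing coefficients
  in \<open>x\<close> on the right side shows that \<open>\<beta>\<close>, \<open>\<sigma>\<beta>\<close> and \<open>\<tau>\<^sup>3\<beta>\<close> are such combinations too. This
  leaves only \<open>\<beta>(y) = by\<close>, and by commutativity \<open>\<alpha>(x) = ax\<close>. Comparing coefficients once more
  gives \<open>b = \<sigma>(a)\<close>, \<open>a = \<sigma>(b)\<close> and \<open>\<tau>\<^sup>3(a) = \<tau>\<sigma>(b)\<close>, which says that \<open>a = b\<close> lies in the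
  subfield of order \<open>q\<^sup>2\<close>; all its elements qualify.

  \<^emph>\<open>The triples.\<close> For \<open>a\<close> in that subfield, \<open>(ax)y = aP - a\<^sup>q v\<tau>(Q)\<close>. If this depended only on
  \<open>xy\<close> with \<open>a \<noteq> a\<^sup>q\<close>, then \<open>P\<close> and \<open>Q\<close> would be functions of the product, which is refuted by
  writing the product of \<open>u\<close> with itself as a product with \<open>1\<close> (\<open>central_scalar_fixed\<close>).
\<close>

section \<open>Powers of the Frobenius automorphism\<close>

locale frobenius_powers =
  fixes q N :: nat and u :: "'a::finite_field"
  assumes primepow_q: "primepow q" and N_pos: "0 < N"
    and card_field: "CARD('a) = q ^ N"
    and primitive: "primitive_element u"
begin

definition fr :: "nat \<Rightarrow> 'a \<Rightarrow> 'a" where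
  "fr k x = x ^ (q ^ k)"

lemma q_gt_1: "1 < q"
  using primepow_gt_Suc_0[OF primepow_q] by simp

lemma qpow_gt_1: "0 < k \<Longrightarrow> 1 < q ^ k"
  by (rule one_less_power[OF q_gt_1])

lemma q_char_power: obtains j where "q = CHAR('a) ^ j" "0 < j"
proof -
  obtain p j where p: "prime p" "0 < j" "q = p ^ j"
    using primepow_q by (auto simp: primepow_def)
  have "prime CHAR('a)"
    by (rule prime_CHAR_semidom) (simp add: finite_imp_CHAR_pos)
  moreover have "CHAR('a) dvd p ^ (j * N)"
    using CHAR_dvd_CARD[where ?'a = 'a] by (simp add: card_field p power_mult)
  ultimately have "CHAR('a) = p"
    using p(1) by (meson prime_dvd_power primes_dvd_imp_eq)
  with p show thesis by (intro that) auto
qed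

lemma fr_add: "fr k (x + y) = fr k x + fr k y"
proof -
  obtain j where "q = CHAR('a) ^ j" using q_char_power by blast
  moreover have "prime CHAR('a)"
    by (rule prime_CHAR_semidom) (simp add: finite_imp_CHAR_pos)
  ultimately show ?thesis
    unfolding fr_def by (intro freshmans_dream'[where n = "j * k"]) (auto simp: power_mult)
qed

lemma fr_mult: "fr k (x * y) = fr k x * fr k y"
  by (simp add: fr_def power_mult_distrib)

lemma fr_zero [simp]: "fr k 0 = 0"
  using q_gt_1 by (simp add: fr_def)

lemma fr_one [simp]: "fr k 1 = 1"
  by (simp add: fr_def)

lemma fr_minus: "fr k (- x) = - fr k x"
  using fr_add[of k x "- x"] by (simp add: eq_neg_iff_add_eq_0 add.commute)

lemma fr_diff: "fr k (x - y) = fr k x - fr k y"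
  using fr_add[of k x "- y"] by (simp add: fr_minus)

lemma fr_divide: "fr k (x / y) = fr k x / fr k y"
  by (simp add: fr_def power_divide)

lemma fr_power: "fr k (x ^ e) = fr k x ^ e"
  by (simp add: fr_def mult.commute flip: power_mult)

lemma fr_fr: "fr k (fr l x) = fr (k + l) x"
  by (simp add: fr_def mult.commute power_add flip: power_mult)

lemma fr_0 [simp]: "fr 0 x = x"
  by (simp add: fr_def)

lemma fr_eq_0_iff [simp]: "fr k x = 0 \<longleftrightarrow> x = 0"
  using q_gt_1 by (auto simp: fr_def)

lemma fr_inject [simp]: "fr k x = fr k y \<longleftrightarrow> x = y"
  using fr_eq_0_iff[of k "x - y"] by (simp add: fr_diff)

lemma fr_period: "fr (N * j) x = x"
  unfolding fr_def by (rule finite_field_power_card_power_eq_same[where n = j])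
    (simp add: card_field power_mult)

lemma fr_mod: "fr (k mod N) x = fr k x"
  by (metis fr_fr fr_period mod_mult_div_eq)

lemma fr_cong: "[k = l] (mod N) \<Longrightarrow> fr k x = fr l x"
  by (metis cong_def fr_mod)

lemma u_nonzero: "u \<noteq> 0"
proof -
  have "u ^ 1 \<in> range (\<lambda>k. u ^ k)" by blast
  then show ?thesis using primitive by (simp add: primitive_element_def)
qed

lemma nonzero_as_power: "x \<noteq> 0 \<Longrightarrow> \<exists>k. x = u ^ k"
proof -
  assume "x \<noteq> 0"
  then have "x \<in> range (\<lambda>k. u ^ k)"
    using primitive by (simp add: primitive_element_def)
  then show ?thesis by blast
qed

lemma power_card_minus_1: "x \<noteq> 0 \<Longrightarrow> x ^ (q ^ N - 1) = (1::'a)"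
proof -
  assume x: "x \<noteq> 0"
  have "x * x ^ (q ^ N - 1) = x ^ Suc (q ^ N - 1)" by (rule power_Suc[symmetric])
  also have "Suc (q ^ N - 1) = q ^ N" using qpow_gt_1[OF N_pos] by linarith
  also have "x ^ (q ^ N) = x" using fr_period[of 1 x] by (simp add: fr_def)
  finally show ?thesis using x by simp
qed

lemma u_power_mod: "u ^ k = u ^ (k mod (q ^ N - 1))"
proof -
  have "u ^ k = u ^ ((q ^ N - 1) * (k div (q ^ N - 1)) + k mod (q ^ N - 1))"
    by simp
  also have "\<dots> = u ^ (k mod (q ^ N - 1))"
    unfolding power_add power_mult by (simp add: power_card_minus_1 u_nonzero del: One_nat_def)
  finally show ?thesis .
qed

lemma u_power_inj: "inj_on (\<lambda>k. u ^ k) {..<q ^ N - 1}"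
proof (rule eq_card_imp_inj_on)
  have "range (\<lambda>k. u ^ k) \<subseteq> (\<lambda>k. u ^ k) ` {..<q ^ N - 1}"
  proof safe
    fix k :: nat
    have "k mod (q ^ N - 1) < q ^ N - 1"
      using qpow_gt_1[OF N_pos] by simp
    then show "u ^ k \<in> (\<lambda>k. u ^ k) ` {..<q ^ N - 1}"
      by (subst u_power_mod) blast
  qed
  then have "(\<lambda>k. u ^ k) ` {..<q ^ N - 1} = - {0}"
    using primitive by (auto simp: primitive_element_def)
  then show "card ((\<lambda>k. u ^ k) ` {..<q ^ N - 1}) = card {..<q ^ N - 1}"
    by (simp add: Compl_eq_Diff_UNIV card_Diff_singleton card_field)
qed simp

lemma u_power_eq_1_iff: "u ^ k = 1 \<longleftrightarrow> (q ^ N - 1) dvd k"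
proof
  assume "u ^ k = 1"
  then have "u ^ (k mod (q ^ N - 1)) = u ^ 0" using u_power_mod[of k] by simp
  then have "k mod (q ^ N - 1) = 0"
    using qpow_gt_1[OF N_pos] by (intro inj_onD[OF u_power_inj]) auto
  then show "(q ^ N - 1) dvd k" by presburger
next
  assume "(q ^ N - 1) dvd k"
  then show "u ^ k = 1"
    by (metis dvd_imp_mod_0 power_0 u_power_mod)
qed

lemma fr_eq_self_iff: "fr k x = x \<longleftrightarrow> x = 0 \<or> x ^ (q ^ k - 1) = 1"
proof -
  have "fr k x = x * x ^ (q ^ k - 1)"
    using q_gt_1 by (simp add: fr_def flip: power_Suc)
  then show ?thesis by auto
qed

text \<open>
  For \<open>0 < d < N\<close> the generator \<open>u\<close> of the multiplicative group is moved by the power \<open>q ^ d\<close>,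
  because its order \<open>q ^ N - 1\<close> exceeds \<open>q ^ d - 1\<close>.
\<close>
lemma fr_eq_iff: "fr k = fr l \<longleftrightarrow> [k = l] (mod N)"
proof
  have *: "[k = l] (mod N)" if "k \<le> l" "fr k = fr l" for k l
  proof -
    have "fr k (fr (l - k) u) = fr k u"
      unfolding fr_fr using that by (simp del: fr_inject)
    then have "fr ((l - k) mod N) u = u" by (simp add: fr_mod)
    then have "(q ^ N - 1) dvd (q ^ ((l - k) mod N) - 1)"
      by (simp only: fr_eq_self_iff u_power_eq_1_iff u_nonzero simp_thms)
    moreover have "q ^ ((l - k) mod N) - 1 < q ^ N - 1"
      using q_gt_1 N_pos qpow_gt_1[OF N_pos]
      by (intro diff_less_mono power_strict_increasing) (auto simp: Suc_leI)
    ultimately have "q ^ ((l - k) mod N) - 1 = 0"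
      using dvd_imp_le by (metis not_le not_gr_zero)
    then have "(l - k) mod N = 0"
      using qpow_gt_1[of "(l - k) mod N"] by linarith
    then show ?thesis using that(1)
      by (metis cong_altdef_nat cong_sym dvd_eq_mod_eq_0)
  qed
  assume "fr k = fr l"
  then show "[k = l] (mod N)"
    using *[of k l] *[of l k] by (metis cong_sym nle_le)
qed (use fr_cong in blast)

text \<open>
  The nonzero fixed elements form the subgroup of order \<open>q ^ d - 1\<close> of the cyclic group generated
  by \<open>u\<close>: the powers of \<open>u\<close> whose exponent is a multiple of \<open>(q ^ N - 1) div (q ^ d - 1)\<close>.
\<close>
lemma card_fixed_fr:
  assumes "d dvd N" and "0 < d"
  shows "card {x. fr d x = x} = q ^ d"
proof -
  obtain j where j: "N = d * j" using assms(1) by (elim dvdE)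
  have "[(q ^ d) ^ j = 1 ^ j] (mod (q ^ d - 1))"
    using q_gt_1 by (intro cong_pow) (simp add: cong_altdef_nat)
  then have "(q ^ d - 1) dvd (q ^ N - 1)"
    using q_gt_1 by (simp add: cong_altdef_nat j power_mult)
  then obtain s where s: "q ^ N - 1 = (q ^ d - 1) * s" by (elim dvdE)
  have d1: "0 < q ^ d - 1" using qpow_gt_1[OF assms(2)] by simp
  have s0: "0 < s"
    using s qpow_gt_1[OF N_pos] by (cases s) auto
  let ?f = "\<lambda>i. u ^ (s * i)"
  have "{x. fr d x = x} = insert 0 (?f ` {..<q ^ d - 1})"
  proof (intro equalityI subsetI)
    fix x assume "x \<in> {x. fr d x = x}"
    then have x: "x = 0 \<or> x ^ (q ^ d - 1) = 1" by (simp add: fr_eq_self_iff)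
    show "x \<in> insert 0 (?f ` {..<q ^ d - 1})"
    proof (cases "x = 0")
      case False
      then obtain k where k: "x = u ^ k" using nonzero_as_power by blast
      have "x ^ (q ^ d - 1) = 1" using x False by blast
      then have "u ^ (k * (q ^ d - 1)) = 1" unfolding k power_mult .
      then have "(q ^ d - 1) * s dvd k * (q ^ d - 1)"
        by (simp only: u_power_eq_1_iff s)
      then have "s dvd k" using d1 by (simp add: mult.commute)
      then obtain i where i: "k = s * i" by (elim dvdE)
      have "x = u ^ (s * i mod ((q ^ d - 1) * s))"
        unfolding k i s[symmetric] by (rule u_power_mod)
      also have "\<dots> = ?f (i mod (q ^ d - 1))"
        unfolding mult.commute[of "q ^ d - 1" s] mult_mod_right ..
      finally have "x = ?f (i mod (q ^ d - 1))" .
      moreover have "i mod (q ^ d - 1) < q ^ d - 1" using d1 by simp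
      ultimately show ?thesis by blast
    qed simp
  next
    fix x assume x: "x \<in> insert 0 (?f ` {..<q ^ d - 1})"
    have "(u ^ (s * i)) ^ (q ^ d - 1) = 1" for i
    proof -
      have "(u ^ (s * i)) ^ (q ^ d - 1) = u ^ ((q ^ d - 1) * s * i)"
        by (simp add: mult_ac flip: power_mult)
      also have "\<dots> = 1" unfolding u_power_eq_1_iff s by (rule dvd_triv_left)
      finally show ?thesis .
    qed
    then show "x \<in> {x. fr d x = x}"
      using x by (auto simp: fr_eq_self_iff)
  qed
  moreover have "inj_on ?f {..<q ^ d - 1}"
  proof (rule inj_onI)
    fix i k assume ik: "i \<in> {..<q ^ d - 1}" "k \<in> {..<q ^ d - 1}" "?f i = ?f k"
    have "s * i = s * k"
    proof (rule inj_onD[OF u_power_inj])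
      show "u ^ (s * i) = u ^ (s * k)" using ik(3) .
      show "s * i \<in> {..<q ^ N - 1}" "s * k \<in> {..<q ^ N - 1}"
        unfolding s mult.commute[of "q ^ d - 1" s] using ik s0 by simp_all
    qed
    then show "i = k" using s0 by simp
  qed
  ultimately have "card {x. fr d x = x} = Suc (q ^ d - 1)"
    using u_nonzero by (simp add: card_insert_if card_image image_iff)
  then show ?thesis using d1 by simp
qed

text \<open>
  The exponents of the powers that fix \<open>x\<close> are closed under the Euclidean algorithm.
\<close>
lemma fixed_gcd:
  assumes "fr k x = x" and "fr l x = x"
  shows "fr (gcd k l) x = x"
proof (cases "k = 0")
  case False
  have iter: "fr (i * j) x = x" if "fr i x = x" for i j
    using that by (induction j) (simp_all flip: fr_fr)
  obtain a b where "k * a = l * b + gcd k l" using bezout_nat[OF False] by blast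
  then have "fr (gcd k l) (fr (l * b) x) = fr (k * a) x" by (simp add: fr_fr add.commute)
  then show ?thesis by (simp add: iter assms)
qed (use assms in simp)

end



section \<open>Linear independence of automorphisms\<close>

text \<open>
  Dedekind's independence of characters with coefficients taken in a quotient space: the \<open>h i\<close>
  are vectors in a function space and relations are read modulo a subspace \<open>W\<close>. For \<open>W = {0}\<close> this is the
  classical statement; a nontrivial \<open>W\<close> allows comparing coefficients in one of two
  variables while the dependence on the other one is only known up to a span. The classical proof by
  shortening a relation carries over.
\<close>
lemma dedekind_independence_mod_subspace:
  fixes \<chi> :: "'i \<Rightarrow> 'c::monoid_mult \<Rightarrow> 'a::field" and h :: "'i \<Rightarrow> 'b \<Rightarrow> 'a"
  assumes "finite I"
    and one: "\<And>i. i \<in> I \<Longrightarrow> \<chi> i 1 = 1"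
    and mult: "\<And>i x y. i \<in> I \<Longrightarrow> \<chi> i (x * y) = \<chi> i x * \<chi> i y"
    and inj: "inj_on \<chi> I"
    and W_add: "\<And>g h. g \<in> W \<Longrightarrow> h \<in> W \<Longrightarrow> (\<lambda>y. g y + h y) \<in> W"
    and W_scale: "\<And>c h. h \<in> W \<Longrightarrow> (\<lambda>y. c * h y) \<in> W"
    and comb: "\<And>x. (\<lambda>y. \<Sum>i\<in>I. \<chi> i x * h i y) \<in> W"
    and "i \<in> I"
  shows "h i \<in> W"
  using assms(1,2,3,4,7,8)
proof (induction I arbitrary: h i rule: finite_induct)
  case (insert k I)
  have W_diff: "(\<lambda>y. f y - g y) \<in> W" if "f \<in> W" "g \<in> W" for f g
    using W_add[OF that(1) W_scale[OF that(2), of "-1"]] by simp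
  have rest: "h j \<in> W" if j: "j \<in> I" for j
  proof -
    obtain z where z: "\<chi> j z \<noteq> \<chi> k z"
      using insert.hyps(2) insert.prems(3) j by (metis ext inj_onD insertCI)
    \<comment> \<open>Translating by \<open>z\<close> and subtracting \<open>\<chi> k z\<close> times the relation removes the index \<open>k\<close>.\<close>
    have "(\<lambda>y. (\<chi> j z - \<chi> k z) * h j y) \<in> W"
    proof (rule insert.IH[where h = "\<lambda>i y. (\<chi> i z - \<chi> k z) * h i y"])
      fix x
      have "(\<lambda>y. (\<Sum>i\<in>insert k I. \<chi> i (x * z) * h i y)
               - \<chi> k z * (\<Sum>i\<in>insert k I. \<chi> i x * h i y)) \<in> W"
        by (intro W_diff W_scale insert.prems(4))
      also have "(\<lambda>y. (\<Sum>i\<in>insert k I. \<chi> i (x * z) * h i y)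
               - \<chi> k z * (\<Sum>i\<in>insert k I. \<chi> i x * h i y))
             = (\<lambda>y. \<Sum>i\<in>I. \<chi> i x * ((\<chi> i z - \<chi> k z) * h i y))"
      proof
        fix y
        have "(\<Sum>i\<in>insert k I. \<chi> i (x * z) * h i y) - \<chi> k z * (\<Sum>i\<in>insert k I. \<chi> i x * h i y)
           = (\<Sum>i\<in>insert k I. \<chi> i x * ((\<chi> i z - \<chi> k z) * h i y))"
          unfolding sum_distrib_left sum_subtractf[symmetric]
          by (intro sum.cong) (auto simp: insert.prems(2) algebra_simps)
        then show "(\<Sum>i\<in>insert k I. \<chi> i (x * z) * h i y)
                - \<chi> k z * (\<Sum>i\<in>insert k I. \<chi> i x * h i y)
           = (\<Sum>i\<in>I. \<chi> i x * ((\<chi> i z - \<chi> k z) * h i y))"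
          using insert.hyps by simp
      qed
      finally show "(\<lambda>y. \<Sum>i\<in>I. \<chi> i x * ((\<chi> i z - \<chi> k z) * h i y)) \<in> W" .
    qed (use insert.prems j in \<open>auto simp: inj_on_insert\<close>)
    from W_scale[OF this, of "inverse (\<chi> j z - \<chi> k z)"] show ?thesis
      using z by (simp add: mult.assoc[symmetric])
  qed
  show ?case
  proof (cases "i = k")
    case True
    have zero: "(\<lambda>y. 0) \<in> W"
      using W_scale[OF insert.prems(4)[of 1], of 0] by simp
    have "(\<lambda>y. \<Sum>i\<in>J. h i y) \<in> W" if "J \<subseteq> I" for J
      using finite_subset[OF that insert.hyps(1)] that
      by (induction J rule: finite_induct) (auto simp: zero intro!: W_add rest)
    from W_diff[OF insert.prems(4)[of 1] this[OF subset_refl]] show ?thesis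
      using True insert.hyps insert.prems(1) by simp
  qed (use insert.prems(5) rest in auto)
qed simp

context frobenius_powers
begin

text \<open>
  Comparison of coefficients for the powers of the Frobenius map. Exponents that agree modulo \<open>N\<close>
  denote the same automorphism, so the conclusion collects their coefficients; the list of exponents
  may therefore contain coincidences, which do occur below when \<open>m = 1\<close> and \<open>n = 2\<close>.
\<close>
lemma coefficient_in_subspace:
  fixes ps :: "(nat \<times> ('b \<Rightarrow> 'a)) list"
  assumes W_add: "\<And>g h. g \<in> W \<Longrightarrow> h \<in> W \<Longrightarrow> (\<lambda>y. g y + h y) \<in> W"
    and W_scale: "\<And>c h. h \<in> W \<Longrightarrow> (\<lambda>y. c * h y) \<in> W"
    and comb: "\<And>x. (\<lambda>y. \<Sum>(k, h)\<leftarrow>ps. fr k x * h y) \<in> W"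
  shows "(\<lambda>y. \<Sum>(k, h)\<leftarrow>ps. if [k = r] (mod N) then h y else 0) \<in> W"
proof -
  define H where "H = (\<lambda>r y. \<Sum>(k, h)\<leftarrow>ps. if [k = r] (mod N) then h y else 0)"
  have "H (r mod N) \<in> W"
  proof (rule dedekind_independence_mod_subspace[where I = "{..<N}" and \<chi> = fr])
    show "inj_on fr {..<N}"
      by (intro inj_onI) (simp add: fr_eq_iff cong_def)
    fix x
    have "(\<Sum>i<N. fr i x * H i y) = (\<Sum>(k, h)\<leftarrow>ps. fr k x * h y)" for y
      unfolding H_def
    proof (induction ps)
      case (Cons p ps)
      obtain k h where p: "p = (k, h)" by fastforce
      have "(\<Sum>i<N. fr i x * (if [k = i] (mod N) then h y else 0))
          = (\<Sum>i<N. if i = k mod N then fr i x * h y else 0)"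
        by (intro sum.cong) (auto simp: cong_def)
      also have "\<dots> = fr k x * h y"
        using N_pos by (simp add: fr_mod)
      finally show ?case
        using Cons.IH by (simp add: p distrib_left sum.distrib)
    qed simp
    then show "(\<lambda>y. \<Sum>i<N. fr i x * H i y) \<in> W"
      using comb by simp
  qed (use N_pos W_add W_scale in \<open>auto simp: fr_mult\<close>)
  then show ?thesis by (simp add: H_def cong_def)
qed

lemma coefficient_zero:
  assumes "\<And>x. (\<Sum>(k, c)\<leftarrow>ps. c * fr k x) = 0"
  shows "(\<Sum>(k, c)\<leftarrow>ps. if [k = r] (mod N) then c else 0) = 0"
proof -
  let ?ps = "map (\<lambda>(k, c). (k, \<lambda>y::unit. c)) ps"
  have "(\<lambda>y. \<Sum>(k, h)\<leftarrow>?ps. if [k = r] (mod N) then h y else 0) \<in> {\<lambda>y. 0}"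
    by (rule coefficient_in_subspace)
       (use assms in \<open>auto simp: o_def case_prod_unfold mult.commute\<close>)
  then show ?thesis
    by (auto simp: o_def case_prod_unfold fun_eq_iff cong: if_cong)
qed

end

section \<open>Bierbrauer multiplications have no zero divisors\<close>

locale bierbrauer = frobenius_powers q "4 * m" u
  for q m :: nat and u :: "'a::finite_field" +
  fixes n :: nat and v :: 'a
  assumes odd_q: "odd q" and m_pos: "m \<ge> 1" and n_pos: "0 < n" and n_less: "n < 4 * m"
    and coprime_mn: "coprime m n"
    and odd_quotient: "odd (2 * m div gcd (2 * m) n)"
    and qm_mod_4: "[q ^ m = 1] (mod 4)" and qn_mod_4: "[q ^ n = 1] (mod 4)"
    and v_def: "v = u ^ (q ^ m - 1)"
begin

definition bar :: "'a \<Rightarrow> 'a" where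
  "bar x = fr (2 * m) x"

text \<open>
  With \<open>\<sigma> = fr n\<close> and \<open>\<tau> = fr m\<close>, the product is \<open>P\<close>, in which \<open>\<tau>\<close> does not occur, minus \<open>v\<close> times
  the image of \<open>Q\<close> under \<open>\<tau>\<close> (\<open>bmult_eq\<close>); the two forms differ only by bars.
\<close>
definition P :: "'a \<Rightarrow> 'a \<Rightarrow> 'a" where
  "P x y = fr n y * x + y * fr n x"

definition Q :: "'a \<Rightarrow> 'a \<Rightarrow> 'a" where
  "Q x y = fr n y * bar x + bar y * fr n x"

abbreviation bmult :: "'a \<Rightarrow> 'a \<Rightarrow> 'a"  (infixl \<open>\<star>\<close> 70) where
  "bmult \<equiv> bierbrauer_mult q m n v"

lemma bmult_eq: "x \<star> y = P x y - v * fr m (Q x y)"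
proof -
  have "m + 2 * m = 3 * m" by simp
  then show ?thesis
    by (simp add: P_def Q_def bar_def fr_add fr_mult fr_fr bierbrauer_mult_def flip: fr_def)
qed

lemma bmult_commute: "x \<star> y = y \<star> x"
  by (simp add: bierbrauer_mult_def algebra_simps)

lemma bar_bar [simp]: "bar (bar x) = x"
  using fr_period[of 1 x] by (simp add: bar_def fr_fr)

lemma bar_eq_0_iff [simp]: "bar x = 0 \<longleftrightarrow> x = 0"
  by (simp add: bar_def)

lemma bar_add: "bar (x + y) = bar x + bar y"
  and bar_diff: "bar (x - y) = bar x - bar y"
  and bar_mult: "bar (x * y) = bar x * bar y"
  and bar_divide: "bar (x / y) = bar x / bar y"
  by (simp_all add: bar_def fr_add fr_diff fr_mult fr_divide)

lemma bar_fr: "bar (fr k x) = fr k (bar x)"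
  by (simp add: bar_def fr_fr add.commute)

lemma fr_m_fr_m: "fr m (fr m x) = bar x"
  by (simp add: bar_def fr_fr mult_2)

text \<open>
  This turns the factor \<open>v\<close> into an application of \<open>\<tau>\<close>: the equation \<open>P = v * \<tau> Q\<close> becomes
  \<open>u * P = \<tau> (u * Q)\<close>.
\<close>
lemma v_mult_u: "v * u = fr m u"
proof -
  have "v * u = u ^ Suc (q ^ m - 1)" by (simp add: v_def)
  also have "Suc (q ^ m - 1) = q ^ m" using q_gt_1 by simp
  finally show ?thesis by (simp add: fr_def)
qed

lemma v_nonzero: "v \<noteq> 0"
  using u_nonzero by (simp add: v_def)

lemma two_nonzero: "(2::'a) \<noteq> 0"
proof
  assume "(2::'a) = 0"
  then have "of_nat 2 = (0::'a)" by simp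
  then have "CHAR('a) dvd 2" by (simp only: of_nat_eq_0_iff_char_dvd)
  moreover have "prime CHAR('a)"
    by (rule prime_CHAR_semidom) (simp add: finite_imp_CHAR_pos)
  ultimately have "CHAR('a) = 2" by (simp add: primes_dvd_imp_eq)
  moreover obtain j where "q = CHAR('a) ^ j" "0 < j" by (rule q_char_power)
  ultimately show False using odd_q by simp
qed

text \<open>
  If \<open>n\<close> were odd, the greatest common divisor of \<open>2 * m\<close> and \<open>n\<close> would be odd, and the quotient
  would retain the factor 2.
\<close>
lemma even_n: "even n"
proof (rule ccontr)
  assume "odd n"
  then have "odd (gcd (2 * m) n)" by (meson dvd_trans gcd_dvd2)
  moreover have "2 * m = gcd (2 * m) n * (2 * m div gcd (2 * m) n)" by simp
  ultimately have "odd (2 * m)" using odd_quotient by (metis even_mult_iff)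
  then show False by simp
qed

lemma odd_m: "odd m"
  using even_n coprime_mn by (metis coprime_common_divisor odd_one)

text \<open>
  Raising to the power \<open>half\<close> is the quadratic character of the fixed field of \<open>bar\<close>.
\<close>
definition half :: nat where
  "half = (q ^ (2 * m) - 1) div 2"

lemma two_half: "2 * half = q ^ (2 * m) - 1"
  unfolding half_def using odd_q by simp

lemma odd_half_succ: "[a = 1] (mod 4) \<Longrightarrow> odd ((a + 1) div 2)" for a :: nat
  unfolding cong_def by presburger

lemma half_factor: "half = (q ^ m - 1) * ((q ^ m + 1) div 2)"
proof -
  have "2 * ((q ^ m + 1) div 2) = q ^ m + 1" using odd_q by simp
  then have "2 * ((q ^ m - 1) * ((q ^ m + 1) div 2)) = (q ^ m - 1) * (q ^ m + 1)"
    by (metis mult.left_commute)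
  also have "\<dots> = q ^ (2 * m) - 1"
    by (simp add: algebra_simps power_mult power2_eq_square[of "q ^ m"] mult.commute[of 2])
  finally show ?thesis using two_half by linarith
qed

lemma fr_scale_power:
  assumes "fr k z = c * z" and "z \<noteq> 0"
  shows "z ^ (q ^ k - 1) = c"
proof -
  have "z ^ (q ^ k - 1) * z = z ^ Suc (q ^ k - 1)" by simp
  also have "Suc (q ^ k - 1) = q ^ k" using q_gt_1 by simp
  also have "z ^ (q ^ k) = c * z" using assms(1) by (simp add: fr_def)
  finally show ?thesis using assms(2) by simp
qed

lemma sign_odd_power: "c = 1 \<or> c = - 1 \<Longrightarrow> odd k \<Longrightarrow> c ^ k = (c::'a)"
  by auto

text \<open>
  The exponent \<open>half\<close> is \<open>q ^ m - 1\<close> times an odd number because \<open>q ^ m\<close> is 1 modulo 4, so the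
  character returns the eigenvalue of \<open>\<tau>\<close>.
\<close>
lemma half_power_eigenvector:
  assumes "fr m z = c * z" and "z \<noteq> 0" and c: "c = 1 \<or> c = - 1"
  shows "z ^ half = c"
proof -
  have "z ^ half = (z ^ (q ^ m - 1)) ^ ((q ^ m + 1) div 2)"
    by (simp add: half_factor flip: power_mult)
  also have "\<dots> = c"
    by (simp only: fr_scale_power[OF assms(1,2)] sign_odd_power[OF c odd_half_succ[OF qm_mod_4]])
  finally show ?thesis .
qed

text \<open>
  Here \<open>t * \<sigma> t\<close> is the power of \<open>t\<close> with exponent \<open>q ^ n + 1\<close>, which is twice an odd number, and
  \<open>t ^ (2 * half)\<close> is the eigenvalue of \<open>t\<close> under \<open>bar\<close>.
\<close>
lemma half_power_sigma_norm:
  assumes "bar t = c * t" and "t \<noteq> 0" and c: "c = 1 \<or> c = - 1"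
  shows "(t * fr n t) ^ half = c"
proof -
  have e: "2 * ((q ^ n + 1) div 2) = q ^ n + 1" using odd_q by simp
  have "t * fr n t = t ^ (2 * ((q ^ n + 1) div 2))" unfolding e by (simp add: fr_def)
  then have "(t * fr n t) ^ half = t ^ (2 * ((q ^ n + 1) div 2) * half)"
    by (simp only: power_mult)
  also have "2 * ((q ^ n + 1) div 2) * half = 2 * half * ((q ^ n + 1) div 2)"
    by (simp only: mult_ac)
  also have "t ^ (2 * half * ((q ^ n + 1) div 2)) = (t ^ (q ^ (2 * m) - 1)) ^ ((q ^ n + 1) div 2)"
    by (simp only: two_half power_mult)
  also have "\<dots> = c"
    by (simp only: fr_scale_power[OF assms(1)[unfolded bar_def] assms(2)]
        sign_odd_power[OF c odd_half_succ[OF qn_mod_4]])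
  finally show ?thesis .
qed

lemma half_power_square:
  assumes "bar e = e" and "e \<noteq> 0"
  shows "(e ^ 2) ^ half = 1"
proof -
  have "(e ^ 2) ^ half = e ^ (2 * half)" by (rule power_mult[symmetric])
  also have "\<dots> = 1"
    unfolding two_half using assms by (intro fr_scale_power) (simp_all add: bar_def)
  finally show ?thesis .
qed

text \<open>
  The norm of a primitive element is not a square in the subfield: the power in question is \<open>u\<close> to half of
  the group order.
\<close>
lemma half_power_norm_u: "(u * bar u) ^ half = - 1"
proof -
  have "u * bar u = u ^ (q ^ (2 * m) + 1)" by (simp add: bar_def fr_def)
  then have w: "(u * bar u) ^ half = u ^ ((q ^ (2 * m) + 1) * half)"
    by (simp only: power_mult)
  have prod: "2 * ((q ^ (2 * m) + 1) * half) = q ^ (4 * m) - 1"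
  proof -
    have "2 * ((q ^ (2 * m) + 1) * half) = (q ^ (2 * m) + 1) * (q ^ (2 * m) - 1)"
      unfolding two_half[symmetric] by (rule mult.left_commute)
    also have "\<dots> = q ^ (2 * m) * q ^ (2 * m) - 1" by (simp add: algebra_simps)
    finally show ?thesis by (simp flip: power_add)
  qed
  have pos: "1 < q ^ (4 * m)" using qpow_gt_1[of "4 * m"] m_pos by simp
  have "\<not> (q ^ (4 * m) - 1) dvd ((q ^ (2 * m) + 1) * half)"
  proof
    assume "(q ^ (4 * m) - 1) dvd ((q ^ (2 * m) + 1) * half)"
    moreover have "0 < (q ^ (2 * m) + 1) * half" using prod pos by linarith
    ultimately have "q ^ (4 * m) - 1 \<le> (q ^ (2 * m) + 1) * half" by (rule dvd_imp_le)
    then show False using prod pos by linarith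
  qed
  then have "(u * bar u) ^ half \<noteq> 1" unfolding w u_power_eq_1_iff .
  moreover have "((u * bar u) ^ half)\<^sup>2 = 1"
    unfolding w power_mult[symmetric] u_power_eq_1_iff
    by (simp only: mult.commute[of _ 2] prod dvd_refl)
  ultimately show ?thesis by (simp add: power2_eq_1_iff)
qed

text \<open>
  The terms symmetric under exchanging \<open>x\<close> with \<open>bar x\<close> cancel in the difference of the two norms, and
  the remaining ones factor.
\<close>
lemma norm_P_minus_norm_Q:
  defines "t \<equiv> \<lambda>x y. bar y * x - y * bar x"
  shows "P x y * bar (P x y) - Q x y * bar (Q x y) = - (t x y * fr n (t x y))"
  unfolding P_def Q_def t_def
  by (simp only: fr_add fr_diff fr_mult bar_add bar_mult bar_fr bar_bar) (simp add: algebra_simps)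

text \<open>
  The quadratic character is evaluated twice: on \<open>w * t * \<sigma> t\<close>, which forces \<open>t = 0\<close>, and then on
  \<open>w * R\<close>, where \<open>w\<close> and \<open>R\<close> are the norms of \<open>u\<close> and \<open>Q\<close>.
\<close>
lemma no_zero_divisors:
  assumes "x \<star> y = 0"
  shows "x = 0 \<or> y = 0"
proof (rule ccontr)
  assume "\<not> (x = 0 \<or> y = 0)"
  then have x: "x \<noteq> 0" and y: "y \<noteq> 0" by auto
  define w where "w = u * bar u"
  define t where "t = bar y * x - y * bar x"
  define R where "R = Q x y * bar (Q x y)"
  have w0: "w \<noteq> 0" using u_nonzero by (simp add: w_def)
  have barw: "bar w = w" by (simp add: w_def bar_mult mult.commute)
  have barR: "bar R = R" by (simp add: R_def bar_mult mult.commute)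
  have "u * P x y = u * v * fr m (Q x y)" using assms by (simp add: bmult_eq mult.assoc)
  then have uP: "u * P x y = fr m (u * Q x y)"
    by (simp add: fr_mult mult.commute[of u v] v_mult_u)
  have "w * (P x y * bar (P x y)) = (u * P x y) * bar (u * P x y)"
    by (simp add: w_def bar_mult mult_ac)
  also have "\<dots> = fr m (w * R)"
    unfolding uP by (simp add: w_def R_def fr_mult bar_mult bar_fr mult_ac)
  finally have normP: "w * (P x y * bar (P x y)) = fr m (w * R)" .
  have "fr m (w * R) - w * R = w * (P x y * bar (P x y) - Q x y * bar (Q x y))"
    using normP by (simp add: R_def right_diff_distrib)
  also have "\<dots> = - (w * (t * fr n t))"
    unfolding norm_P_minus_norm_Q t_def by simp
  finally have z: "w * (t * fr n t) = w * R - fr m (w * R)" by (simp add: algebra_simps)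
  have "fr m (fr m (w * R)) = w * R"
    using barw barR by (simp add: fr_m_fr_m bar_mult)
  then have "fr m (w * (t * fr n t)) = - 1 * (w * (t * fr n t))"
    unfolding z by (simp add: fr_diff)
  moreover have bart: "bar t = - 1 * t"
    unfolding t_def by (simp add: bar_diff bar_mult)
  ultimately have t0: "t = 0"
  proof (rule_tac ccontr)
    assume eig: "fr m (w * (t * fr n t)) = - 1 * (w * (t * fr n t))" and "t \<noteq> 0"
    then have "(w * (t * fr n t)) ^ half = - 1"
      using w0 by (intro half_power_eigenvector) auto
    moreover have "(w * (t * fr n t)) ^ half = 1"
      using half_power_sigma_norm[OF bart \<open>t \<noteq> 0\<close>] half_power_norm_u
      by (simp add: w_def power_mult_distrib)
    ultimately show False using two_nonzero by (simp add: eq_neg_iff_add_eq_0)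
  qed
  \<comment> \<open>The vanishing of \<open>t\<close> says that the quotient \<open>c\<close> of \<open>x\<close> and \<open>y\<close> is fixed by \<open>bar\<close>.\<close>
  define c where "c = x / y"
  have xc: "x = c * y" using y by (simp add: c_def)
  have c0: "c \<noteq> 0" using x y by (simp add: c_def)
  have barc: "bar c = c"
    using t0 y by (simp add: c_def t_def bar_divide divide_simps mult.commute)
  define e where "e = c + fr n c"
  have bare: "bar e = e"
    by (simp add: e_def bar_add bar_fr barc)
  have "e \<noteq> 0"
  proof
    assume "e = 0"
    then have step: "fr n c = - c" by (simp add: e_def eq_neg_iff_add_eq_0 add.commute)
    \<comment> \<open>On the fixed field of \<open>bar\<close> the map \<open>fr n\<close> has odd order dividing \<open>m\<close>, so \<open>-1\<close> is no eigenvalue.\<close>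
    have "fr (n * j) c = (- 1) ^ j * c" for j
      by (induction j) (simp_all add: fr_minus fr_mult fr_power step flip: fr_fr)
    then have "fr (n * m) c = - c" using odd_m by simp
    moreover have "fr (n * m) c = c"
    proof -
      have "fr (2 * m * j) c = c" for j
        using barc by (induction j) (simp_all add: bar_def flip: fr_fr)
      moreover have "n * m = 2 * m * (n div 2)" using even_n by simp
      ultimately show ?thesis by (simp only:)
    qed
    ultimately have "2 * c = 0" by (simp add: eq_neg_iff_add_eq_0)
    then show False using two_nonzero c0 by simp
  qed
  define s where "s = y * bar y"
  have s0: "s \<noteq> 0" using y by (simp add: s_def)
  have bars: "bar s = 1 * s" by (simp add: s_def bar_mult mult.commute)
  have "Q x y = fr n y * bar y * e"
    unfolding Q_def xc e_def by (simp add: fr_mult bar_mult barc algebra_simps)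
  then have R: "R = s * fr n s * e ^ 2"
    unfolding R_def s_def
    by (simp add: fr_mult bar_mult bar_fr bare power2_eq_square mult_ac)
  have "(w * R) ^ half = - 1"
    using half_power_sigma_norm[OF bars s0] half_power_norm_u half_power_square[OF bare \<open>e \<noteq> 0\<close>]
    by (simp add: R w_def power_mult_distrib)
  moreover have "(w * R) ^ half = 1"
    using z t0 w0 s0 \<open>e \<noteq> 0\<close> by (intro half_power_eigenvector) (auto simp: R)
  ultimately show False using two_nonzero by (simp add: eq_neg_iff_add_eq_0)
qed

lemma bmult_add_left: "(x + y) \<star> z = x \<star> z + y \<star> z"
  by (simp add: bmult_eq P_def Q_def fr_add fr_mult bar_add algebra_simps)

lemma bmult_add_right: "x \<star> (y + z) = x \<star> y + x \<star> z"
  by (simp add: bmult_commute[of x] bmult_add_left)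

lemma bij_bmult: "a \<noteq> 0 \<Longrightarrow> bij (\<lambda>x. x \<star> a)"
proof -
  assume a: "a \<noteq> 0"
  have "inj (\<lambda>x. x \<star> a)"
  proof (rule injI)
    fix x y assume "x \<star> a = y \<star> a"
    moreover have "x \<star> a = (x - y) \<star> a + y \<star> a" by (simp flip: bmult_add_left)
    ultimately have "(x - y) \<star> a = 0" by simp
    then show "x = y" using no_zero_divisors a by fastforce
  qed
  then show ?thesis by (simp add: bij_def finite_UNIV_inj_surj)
qed

lemma presemifield_bmult: "presemifield bmult"
proof
  show "\<exists>x::'a. x \<noteq> 0" using zero_neq_one by metis
  show "x \<star> (y + z) = x \<star> y + x \<star> z" for x y z by (rule bmult_add_right)
  show "(x + y) \<star> z = x \<star> z + y \<star> z" for x y z by (rule bmult_add_left)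
  have *: "\<exists>!x. x \<star> a = b" if "a \<noteq> 0" for a b
    using bij_bmult[OF that] unfolding bij_def inj_def surj_def by metis
  show "\<exists>!x. x \<star> a = b" if "a \<noteq> 0" for a b by (rule *[OF that])
  show "\<exists>!x. a \<star> x = b" if "a \<noteq> 0" for a b
    using *[OF that] by (simp add: bmult_commute[of a])
qed

end

section \<open>Isotopy-invariant forms of middle nucleus and center\<close>

text \<open>
  An element \<open>b\<close> of the middle nucleus enters only through the two multiplications \<open>x \<star> b\<close> and
  \<open>b \<star> y\<close>. Recording these maps instead of \<open>b\<close> makes sense without an identity and is
  compatible with isotopisms.
\<close>
definition middle_pairs :: "('a \<Rightarrow> 'a \<Rightarrow> 'a) \<Rightarrow> (('a \<Rightarrow> 'a) \<times> ('a \<Rightarrow> 'a)) set" where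
  "middle_pairs f = {(\<alpha>, \<beta>). \<forall>x y. f (\<alpha> x) y = f x (\<beta> y)}"

definition central_triples ::
  "('a \<Rightarrow> 'a \<Rightarrow> 'a) \<Rightarrow> (('a \<Rightarrow> 'a) \<times> ('a \<Rightarrow> 'a) \<times> ('a \<Rightarrow> 'a)) set" where
  "central_triples f =
     {(\<alpha>, \<beta>, \<gamma>). \<forall>x y. f (\<alpha> x) y = \<gamma> (f x y) \<and> f x (\<beta> y) = \<gamma> (f x y)}"

text \<open>
  The isotopism conjugates each map of a pair by its own component.
\<close>
lemma card_middle_pairs_isotopic:
  assumes "isotopic f f'"
  shows "card (middle_pairs f) = card (middle_pairs f')"
proof -
  obtain g\<^sub>1 g\<^sub>2 g\<^sub>3 where bij: "bij g\<^sub>1" "bij g\<^sub>2" "bij g\<^sub>3"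
    and iso: "\<And>x y. f' (g\<^sub>1 x) (g\<^sub>2 y) = g\<^sub>3 (f x y)"
    using assms unfolding isotopic_def by blast
  define h\<^sub>1 h\<^sub>2 where "h\<^sub>1 = inv_into UNIV g\<^sub>1" and "h\<^sub>2 = inv_into UNIV g\<^sub>2"
  then have inv [simp]: "h\<^sub>1 (g\<^sub>1 x) = x" "g\<^sub>1 (h\<^sub>1 y) = y" "h\<^sub>2 (g\<^sub>2 x) = x" "g\<^sub>2 (h\<^sub>2 y) = y" for x y
    using bij by (simp_all add: bij_is_inj bij_is_surj surj_f_inv_f)
  let ?T = "\<lambda>(\<alpha>, \<beta>). (g\<^sub>1 \<circ> \<alpha> \<circ> h\<^sub>1, g\<^sub>2 \<circ> \<beta> \<circ> h\<^sub>2)"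
  let ?U = "\<lambda>(\<alpha>, \<beta>). (h\<^sub>1 \<circ> \<alpha> \<circ> g\<^sub>1, h\<^sub>2 \<circ> \<beta> \<circ> g\<^sub>2)"
  have iso': "f' x y = g\<^sub>3 (f (h\<^sub>1 x) (h\<^sub>2 y))" for x y
    using iso[of "h\<^sub>1 x" "h\<^sub>2 y"] by simp
  have "bij_betw ?T (middle_pairs f) (middle_pairs f')"
  proof (rule bij_betw_byWitness[where f' = ?U])
    show "?U ` middle_pairs f' \<subseteq> middle_pairs f"
    proof (clarsimp simp: middle_pairs_def)
      fix \<alpha> \<beta> x y assume "\<forall>x y. f' (\<alpha> x) y = f' x (\<beta> y)"
      then have "f' (\<alpha> (g\<^sub>1 x)) (g\<^sub>2 y) = f' (g\<^sub>1 x) (\<beta> (g\<^sub>2 y))" by blast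
      then show "f (h\<^sub>1 (\<alpha> (g\<^sub>1 x))) y = f x (h\<^sub>2 (\<beta> (g\<^sub>2 y)))"
        by (simp add: iso' bij_is_inj[OF bij(3), THEN inj_eq])
    qed
  qed (auto simp: middle_pairs_def fun_eq_iff iso')
  then show ?thesis by (rule bij_betw_same_card)
qed

lemma card_central_triples_isotopic:
  assumes "isotopic f f'"
  shows "card (central_triples f) = card (central_triples f')"
proof -
  obtain g\<^sub>1 g\<^sub>2 g\<^sub>3 where bij: "bij g\<^sub>1" "bij g\<^sub>2" "bij g\<^sub>3"
    and iso: "\<And>x y. f' (g\<^sub>1 x) (g\<^sub>2 y) = g\<^sub>3 (f x y)"
    using assms unfolding isotopic_def by blast
  define h\<^sub>1 h\<^sub>2 h\<^sub>3 where "h\<^sub>1 = inv_into UNIV g\<^sub>1" and "h\<^sub>2 = inv_into UNIV g\<^sub>2"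
    and "h\<^sub>3 = inv_into UNIV g\<^sub>3"
  then have inv [simp]: "h\<^sub>1 (g\<^sub>1 x) = x" "g\<^sub>1 (h\<^sub>1 y) = y" "h\<^sub>2 (g\<^sub>2 x) = x" "g\<^sub>2 (h\<^sub>2 y) = y"
    "h\<^sub>3 (g\<^sub>3 z) = z" "g\<^sub>3 (h\<^sub>3 w) = w" for x y z w
    using bij by (simp_all add: bij_is_inj bij_is_surj surj_f_inv_f)
  let ?T = "\<lambda>(\<alpha>, \<beta>, \<gamma>). (g\<^sub>1 \<circ> \<alpha> \<circ> h\<^sub>1, g\<^sub>2 \<circ> \<beta> \<circ> h\<^sub>2, g\<^sub>3 \<circ> \<gamma> \<circ> h\<^sub>3)"
  let ?U = "\<lambda>(\<alpha>, \<beta>, \<gamma>). (h\<^sub>1 \<circ> \<alpha> \<circ> g\<^sub>1, h\<^sub>2 \<circ> \<beta> \<circ> g\<^sub>2, h\<^sub>3 \<circ> \<gamma> \<circ> g\<^sub>3)"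
  have iso': "f' x y = g\<^sub>3 (f (h\<^sub>1 x) (h\<^sub>2 y))" for x y
    using iso[of "h\<^sub>1 x" "h\<^sub>2 y"] by simp
  have "bij_betw ?T (central_triples f) (central_triples f')"
  proof (rule bij_betw_byWitness[where f' = ?U])
    show "?U ` central_triples f' \<subseteq> central_triples f"
    proof (clarsimp simp: central_triples_def)
      fix \<alpha> \<beta> \<gamma> x y
      assume "\<forall>x y. f' (\<alpha> x) y = \<gamma> (f' x y) \<and> f' x (\<beta> y) = \<gamma> (f' x y)"
      then have "f' (\<alpha> (g\<^sub>1 x)) (g\<^sub>2 y) = \<gamma> (f' (g\<^sub>1 x) (g\<^sub>2 y))"
        and "f' (g\<^sub>1 x) (\<beta> (g\<^sub>2 y)) = \<gamma> (f' (g\<^sub>1 x) (g\<^sub>2 y))"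
        by blast+
      then show "f (h\<^sub>1 (\<alpha> (g\<^sub>1 x))) y = h\<^sub>3 (\<gamma> (g\<^sub>3 (f x y))) \<and>
          f x (h\<^sub>2 (\<beta> (g\<^sub>2 y))) = h\<^sub>3 (\<gamma> (g\<^sub>3 (f x y)))"
        by (simp add: iso') (metis inv(5))
    qed
  qed (auto simp: central_triples_def fun_eq_iff iso')
  then show ?thesis by (rule bij_betw_same_card)
qed

context semifield
begin

text \<open>
  Evaluating a pair at the identity recovers the element of the nucleus.
\<close>
lemma card_middle_nucleus: "card (middle_nucleus mult) = card (middle_pairs mult)"
proof -
  obtain e where e: "\<And>x. e \<star> x = x" "\<And>x. x \<star> e = x" using identity by blast
  have pair: "(\<lambda>x. x \<star> \<alpha> e) = \<alpha> \<and> (\<star>) (\<alpha> e) = \<beta> \<and> \<alpha> e \<in> middle_nucleus mult"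
    if "(\<alpha>, \<beta>) \<in> middle_pairs mult" for \<alpha> \<beta>
  proof -
    have ab: "\<alpha> x \<star> y = x \<star> \<beta> y" for x y
      using that by (simp add: middle_pairs_def)
    have \<beta>: "\<beta> y = \<alpha> e \<star> y" for y using ab[of e y] by (simp add: e)
    have \<alpha>: "\<alpha> x = x \<star> \<alpha> e" for x using ab[of x e] by (simp add: e \<beta>)
    have "(x \<star> \<alpha> e) \<star> y = x \<star> (\<alpha> e \<star> y)" for x y
      using ab[of x y] by (simp only: \<alpha>[of x, symmetric] \<beta>)
    then have "\<alpha> e \<in> middle_nucleus mult"
      by (simp add: middle_nucleus_def)
    then show ?thesis by (intro conjI ext \<alpha>[symmetric] \<beta>[symmetric])
  qed
  have "bij_betw (\<lambda>b. (\<lambda>x. x \<star> b, (\<star>) b)) (middle_nucleus mult) (middle_pairs mult)"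
  proof (rule bij_betw_byWitness[where f' = "\<lambda>(\<alpha>, \<beta>). \<alpha> e"])
    show "\<forall>p\<in>middle_pairs mult. (\<lambda>b. (\<lambda>x. x \<star> b, (\<star>) b)) ((\<lambda>(\<alpha>, \<beta>). \<alpha> e) p) = p"
    proof
      fix p assume p: "p \<in> middle_pairs mult"
      obtain \<alpha> \<beta> where "p = (\<alpha>, \<beta>)" by (metis prod.exhaust)
      with p pair[of \<alpha> \<beta>] show "(\<lambda>b. (\<lambda>x. x \<star> b, (\<star>) b)) ((\<lambda>(\<alpha>, \<beta>). \<alpha> e) p) = p"
        by simp
    qed
    show "(\<lambda>(\<alpha>, \<beta>). \<alpha> e) ` middle_pairs mult \<subseteq> middle_nucleus mult"
    proof (rule image_subsetI)
      fix p assume p: "p \<in> middle_pairs mult"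
      obtain \<alpha> \<beta> where "p = (\<alpha>, \<beta>)" by (metis prod.exhaust)
      with p pair[of \<alpha> \<beta>] show "(\<lambda>(\<alpha>, \<beta>). \<alpha> e) p \<in> middle_nucleus mult" by simp
    qed
  qed (auto simp: e middle_pairs_def middle_nucleus_def)
  then show ?thesis by (rule bij_betw_same_card)
qed

text \<open>
  Evaluating with the identity in either argument shows that the three maps of a triple coincide, and
  that they are both the left and the right multiplication by the image of the identity.
\<close>
lemma card_center: "card (center mult) = card (central_triples mult)"
proof -
  obtain e where e: "\<And>x. e \<star> x = x" "\<And>x. x \<star> e = x" using identity by blast
  have triple: "\<alpha> = (\<star>) (\<gamma> e) \<and> \<beta> = (\<star>) (\<gamma> e) \<and> \<gamma> = (\<star>) (\<gamma> e) \<and> \<gamma> e \<in> center mult"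
    if "(\<alpha>, \<beta>, \<gamma>) \<in> central_triples mult" for \<alpha> \<beta> \<gamma>
  proof -
    have *: "\<alpha> x \<star> y = \<gamma> (x \<star> y)" "x \<star> \<beta> y = \<gamma> (x \<star> y)" for x y
      using that by (simp_all add: central_triples_def)
    have \<alpha>: "\<alpha> x = \<gamma> x" and \<beta>: "\<beta> x = \<gamma> x" for x
      using *(1)[of x e] *(2)[of e x] by (simp_all add: e)
    have left: "\<gamma> e \<star> x = \<gamma> x" and right: "x \<star> \<gamma> e = \<gamma> x" for x
      using *(1)[of e x] *(2)[of x e] by (simp_all add: e \<alpha> \<beta>)
    have "\<gamma> e \<in> center mult"
      unfolding center_def left_nucleus_def middle_nucleus_def right_nucleus_def
      using * by (simp add: e left right \<alpha> \<beta>)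
    then show ?thesis by (simp add: fun_eq_iff left \<alpha> \<beta>)
  qed
  have "bij_betw (\<lambda>z. ((\<star>) z, (\<star>) z, (\<star>) z)) (center mult) (central_triples mult)"
  proof (rule bij_betw_byWitness[where f' = "\<lambda>(\<alpha>, \<beta>, \<gamma>). \<gamma> e"])
    show "(\<lambda>z. ((\<star>) z, (\<star>) z, (\<star>) z)) ` center mult \<subseteq> central_triples mult"
    proof safe
      fix z assume "z \<in> center mult"
      then have left: "(z \<star> x) \<star> y = z \<star> (x \<star> y)" and middle: "(x \<star> z) \<star> y = x \<star> (z \<star> y)"
        and comm: "z \<star> x = x \<star> z" for x y
        by (auto simp: center_def left_nucleus_def middle_nucleus_def)
      have "x \<star> (z \<star> y) = z \<star> (x \<star> y)" for x y
        by (metis left middle comm)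
      then show "((\<star>) z, (\<star>) z, (\<star>) z) \<in> central_triples mult"
        by (simp add: central_triples_def left)
    qed
    show "\<forall>p\<in>central_triples mult. (\<lambda>z. ((\<star>) z, (\<star>) z, (\<star>) z)) ((\<lambda>(\<alpha>, \<beta>, \<gamma>). \<gamma> e) p) = p"
      using triple by (clarsimp simp: Ball_def) metis
    show "(\<lambda>(\<alpha>, \<beta>, \<gamma>). \<gamma> e) ` central_triples mult \<subseteq> center mult"
    proof (rule image_subsetI)
      fix p assume p: "p \<in> central_triples mult"
      obtain \<alpha> \<beta> \<gamma> where "p = (\<alpha>, \<beta>, \<gamma>)" by (metis prod.exhaust)
      with p triple[of \<alpha> \<beta> \<gamma>] show "(\<lambda>(\<alpha>, \<beta>, \<gamma>). \<gamma> e) p \<in> center mult" by simp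
    qed
  qed (simp add: e)
  then show ?thesis by (rule bij_betw_same_card)
qed

end


section \<open>Congruences between the exponents\<close>

context bierbrauer
begin

text \<open>
  As \<open>n\<close> is even and \<open>m\<close> is odd, parity separates the exponents \<open>0\<close>, \<open>n\<close> from \<open>3 * m\<close>, \<open>m + n\<close>.
\<close>
lemma noncong_parity: "even a \<noteq> even b \<Longrightarrow> \<not> [a = b] (mod 4 * m)" for a b :: nat
proof
  assume "[a = b] (mod 4 * m)"
  then have "[a = b] (mod 2)" by (rule cong_dvd_modulus_nat) simp
  then have "even a = even b" by (rule cong_dvd_iff)
  moreover assume "even a \<noteq> even b"
  ultimately show False by blast
qed

lemma n_not_cong_0: "\<not> [0 = n] (mod 4 * m)" "\<not> [n = 0] (mod 4 * m)"
  using n_pos n_less by (auto simp: cong_def)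

text \<open>
  This exceptional case has to be treated apart: it is the only one in which two of the exponents
  \<open>0\<close>, \<open>n\<close>, \<open>3 * m\<close>, \<open>m + n\<close> coincide modulo \<open>4 * m\<close>.
\<close>
lemma degenerate_case:
  assumes "m dvd n" shows "m = 1 \<and> n = 2"
proof -
  have "m = 1" using coprime_mn assms by (simp add: coprime_absorb_left)
  then show ?thesis using n_pos n_less even_n by presburger
qed

lemma cong_differenceE:
  assumes "[a = b] (mod 4 * m)" 
  obtains k :: int where "int a = int b + 4 * int m * k"
proof -
  have "[int a = int b] (mod (4 * int m))"
    using assms by (simp flip: cong_int_iff)
  then obtain k where "int a - int b = 4 * int m * k"
    by (auto simp: cong_iff_dvd_diff elim: dvdE)
  then show thesis by (intro that[of k]) simp
qed

text \<open>
  Each of these congruences would make \<open>m\<close> a divisor of \<open>n\<close>.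
\<close>
lemma generic_noncongruences:
  assumes "\<not> (m = 1 \<and> n = 2)"
  shows "\<not> [3 * m = m + n] (mod 4 * m)" and "\<not> [0 = n + n] (mod 4 * m)"
    and "\<not> [3 * m = n + (m + n)] (mod 4 * m)" and "\<not> [m + n = 3 * m] (mod 4 * m)"
proof -
  have ndvd: False if "2 * int n = 2 * (int m * k)" for k
  proof -
    have "int m dvd int n" using that by simp
    then show False using degenerate_case assms by simp
  qed
  show *: "\<not> [3 * m = m + n] (mod 4 * m)"
  proof
    assume "[3 * m = m + n] (mod 4 * m)"
    then obtain k where "int (3 * m) = int (m + n) + 4 * int m * k" by (rule cong_differenceE)
    then have "2 * int n = 2 * (int m * (2 - 4 * k))" by (simp add: algebra_simps)
    then show False by (rule ndvd)
  qed
  then show "\<not> [m + n = 3 * m] (mod 4 * m)" using cong_sym by blast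
  show "\<not> [0 = n + n] (mod 4 * m)"
  proof
    assume "[0 = n + n] (mod 4 * m)"
    then obtain k where "int 0 = int (n + n) + 4 * int m * k" by (rule cong_differenceE)
    then have "2 * int n = 2 * (int m * (- 2 * k))" by (simp add: algebra_simps)
    then show False by (rule ndvd)
  qed
  show "\<not> [3 * m = n + (m + n)] (mod 4 * m)"
  proof
    assume "[3 * m = n + (m + n)] (mod 4 * m)"
    then obtain k where "int (3 * m) = int (n + (m + n)) + 4 * int m * k"
      by (rule cong_differenceE)
    then have "3 * int m = int m + 2 * int n + 4 * int m * k" by simp
    then have "2 * int n = 2 * int m - 4 * int m * k" by linarith
    also have "\<dots> = 2 * (int m * (1 - 2 * k))" by (simp add: algebra_simps)
    finally have "2 * int n = 2 * (int m * (1 - 2 * k))" .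
    then show False by (rule ndvd)
  qed
qed

end

section \<open>Middle nucleus and center of the Bierbrauer presemifield\<close>

context bierbrauer
begin

lemma bmult_expand:
  "x \<star> y = fr n y * x + y * fr n x - v * (fr (m + n) y * fr (3 * m) x + fr (3 * m) y * fr (m + n) x)"
  by (simp add: bierbrauer_mult_def fr_def)

text \<open>
  The span of the automorphisms that occur in the product as a function of either argument.
\<close>
definition bspan :: "('a \<Rightarrow> 'a) set" where
  "bspan = {h. \<exists>a b c d. \<forall>y. h y = a * y + b * fr n y + c * fr (3 * m) y + d * fr (m + n) y}"

lemma bspan_add: "g \<in> bspan \<Longrightarrow> h \<in> bspan \<Longrightarrow> (\<lambda>y. g y + h y) \<in> bspan"
proof -
  assume "g \<in> bspan" "h \<in> bspan"
  then obtain a b c d a' b' c' d' where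
    "\<And>y. g y = a * y + b * fr n y + c * fr (3 * m) y + d * fr (m + n) y"
    "\<And>y. h y = a' * y + b' * fr n y + c' * fr (3 * m) y + d' * fr (m + n) y"
    unfolding bspan_def by blast
  then show ?thesis
    unfolding bspan_def mem_Collect_eq
    by (intro exI[of _ "a + a'"] exI[of _ "b + b'"] exI[of _ "c + c'"] exI[of _ "d + d'"])
       (simp add: algebra_simps)
qed

lemma bspan_scale: "h \<in> bspan \<Longrightarrow> (\<lambda>y. e * h y) \<in> bspan"
proof -
  assume "h \<in> bspan"
  then obtain a b c d where
    "\<And>y. h y = a * y + b * fr n y + c * fr (3 * m) y + d * fr (m + n) y"
    unfolding bspan_def by blast
  then show ?thesis
    unfolding bspan_def mem_Collect_eq
    by (intro exI[of _ "e * a"] exI[of _ "e * b"] exI[of _ "e * c"] exI[of _ "e * d"])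
       (simp add: algebra_simps)
qed

lemma bspan_cancel: "(\<lambda>y. e * h y) \<in> bspan \<Longrightarrow> e \<noteq> 0 \<Longrightarrow> h \<in> bspan"
  using bspan_scale[of "\<lambda>y. e * h y" "inverse e"] by (simp flip: mult.assoc)

lemma bmult_in_bspan: "(\<lambda>y. x \<star> y) \<in> bspan"
  unfolding bspan_def mem_Collect_eq
  by (intro exI[of _ "fr n x"] exI[of _ x] exI[of _ "- v * fr (m + n) x"]
       exI[of _ "- v * fr (3 * m) x"])
     (simp add: bmult_expand algebra_simps)

text \<open>
  In \<open>x \<star> g y\<close> the automorphisms \<open>fr n\<close>, \<open>fr 0\<close> and \<open>fr (m + n)\<close> of \<open>x\<close> have the coefficients
  \<open>g y\<close>, \<open>fr n (g y)\<close> and, up to a constant, \<open>fr (3 * m) (g y)\<close>. For each fixed \<open>x\<close> the whole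
  expression equals \<open>f x \<star> y\<close>, which lies in the span.
\<close>
lemma coefficients_in_bspan:
  assumes fg: "\<And>x y. f x \<star> y = x \<star> g y"
  shows "g \<in> bspan" and "(\<lambda>y. fr n (g y)) \<in> bspan" and "(\<lambda>y. fr (3 * m) (g y)) \<in> bspan"
proof -
  let ?ps = "[(0, \<lambda>y. fr n (g y)), (n, g), (3 * m, \<lambda>y. - v * fr (m + n) (g y)),
      (m + n, \<lambda>y. - v * fr (3 * m) (g y))]"
  have coeff: "(\<lambda>y. \<Sum>(k, h)\<leftarrow>?ps. if [k = r] (mod 4 * m) then h y else 0) \<in> bspan" for r
  proof (rule coefficient_in_subspace[OF bspan_add bspan_scale])
    fix x
    have "(\<lambda>y. \<Sum>(k, h)\<leftarrow>?ps. fr k x * h y) = (\<lambda>y. f x \<star> y)"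
      unfolding fg by (simp add: bmult_expand algebra_simps)
    then show "(\<lambda>y. \<Sum>(k, h)\<leftarrow>?ps. fr k x * h y) \<in> bspan"
      using bmult_in_bspan by simp
  qed
  show "g \<in> bspan"
    using coeff[of n] n_not_cong_0 odd_m even_n by (simp add: noncong_parity)
  show "(\<lambda>y. fr n (g y)) \<in> bspan"
    using coeff[of 0] n_not_cong_0 odd_m even_n by (simp add: noncong_parity)
  show "(\<lambda>y. fr (3 * m) (g y)) \<in> bspan"
  proof (cases "m = 1 \<and> n = 2")
    case True
    then have e: "m + n = 3 * m" by simp
    have "(\<lambda>y. - (v * fr (3 * m) (g y)) - v * fr (3 * m) (g y)) \<in> bspan"
      using coeff[of "3 * m"] odd_m even_n by (simp add: e noncong_parity)
    also have "(\<lambda>y. - (v * fr (3 * m) (g y)) - v * fr (3 * m) (g y))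
        = (\<lambda>y. (- 2 * v) * fr (3 * m) (g y))"
      by (simp add: fun_eq_iff algebra_simps)
    finally show ?thesis by (rule bspan_cancel) (simp add: two_nonzero v_nonzero)
  next
    case False
    then have "(\<lambda>y. - v * fr (3 * m) (g y)) \<in> bspan"
      using coeff[of "m + n"] odd_m even_n generic_noncongruences(1) by (simp add: noncong_parity)
    then show ?thesis by (rule bspan_cancel) (simp add: v_nonzero)
  qed
qed

text \<open>
  Applying \<open>fr k\<close> shifts the exponents of \<open>g\<close> by \<open>k\<close>, and the result must again have its exponents among
  \<open>0\<close>, \<open>n\<close>, \<open>3 * m\<close>, \<open>m + n\<close>. A shift by \<open>n\<close> leaves only the exponent 0 unless \<open>m = 1\<close> and
  \<open>n = 2\<close>. In that case the exponents are 0, 2, 3 modulo 4; the shift by 2 excludes 3, and the shift by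
  \<open>3 * m = 3\<close> excludes 2, both because 1 is not among them.
\<close>
lemma scalar_if_translates_in_bspan:
  assumes "g \<in> bspan" and "(\<lambda>y. fr n (g y)) \<in> bspan" and "(\<lambda>y. fr (3 * m) (g y)) \<in> bspan"
  obtains a where "\<And>y. g y = a * y"
proof -
  obtain a b c d where g: "\<And>y. g y = a * y + b * fr n y + c * fr (3 * m) y + d * fr (m + n) y"
    using assms(1) unfolding bspan_def by blast
  obtain a' b' c' d' where gn:
    "\<And>y. fr n (g y) = a' * y + b' * fr n y + c' * fr (3 * m) y + d' * fr (m + n) y"
    using assms(2) unfolding bspan_def by blast
  let ?ps = "[(n, fr n a), (n + n, fr n b), (n + 3 * m, fr n c), (n + (m + n), fr n d),
      (0, - a'), (n, - b'), (3 * m, - c'), (m + n, - d')]"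
  have coeff: "(\<Sum>(k, c)\<leftarrow>?ps. if [k = r] (mod 4 * m) then c else 0) = 0" for r
  proof (rule coefficient_zero)
    fix y
    show "(\<Sum>(k, c)\<leftarrow>?ps. c * fr k y) = 0"
      using gn[of y] by (simp add: g fr_add fr_mult fr_fr algebra_simps)
  qed
  show thesis
  proof (cases "m = 1 \<and> n = 2")
    case True
    obtain a'' b'' c'' d'' where g3:
      "\<And>y. fr (3 * m) (g y) = a'' * y + b'' * fr n y + c'' * fr (3 * m) y + d'' * fr (m + n) y"
      using assms(3) unfolding bspan_def by blast
    let ?qs = "[(3 * m, fr (3 * m) a), (3 * m + n, fr (3 * m) b), (3 * m + 3 * m, fr (3 * m) c),
        (3 * m + (m + n), fr (3 * m) d), (0, - a''), (n, - b''), (3 * m, - c''), (m + n, - d'')]"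
    have "(\<Sum>(k, c)\<leftarrow>?qs. if [k = 1] (mod 4 * m) then c else 0) = 0"
    proof (rule coefficient_zero)
      fix y
      show "(\<Sum>(k, c)\<leftarrow>?qs. c * fr k y) = 0"
        using g3[of y] by (simp add: g fr_add fr_mult fr_fr algebra_simps)
    qed
    then have "b = 0" using True by (simp add: cong_def)
    moreover have "fr n (c + d) = 0"
      using coeff[of 1] True by (simp add: cong_def fr_add)
    then have "c + d = 0" by simp
    moreover have "m + n = 3 * m" using True by simp
    then have "g y = a * y + b * fr n y + (c + d) * fr (3 * m) y" for y
      by (simp add: g algebra_simps)
    ultimately have "g y = a * y" for y by simp
    then show thesis by (rule that)
  next
    case False
    have mm: "\<not> [m + n = n + 3 * m] (mod 4 * m)"
    proof
      assume "[m + n = n + 3 * m] (mod 4 * m)"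
      then obtain k where "int (m + n) = int (n + 3 * m) + 4 * int m * k"
        by (rule cong_differenceE)
      then have "int m * 2 = int m * (- 4 * k)" by (simp add: algebra_simps)
      then have "2 = - 4 * k" using m_pos unfolding mult_cancel_left by simp
      then show False by presburger
    qed
    have nn: "\<not> [x = n + x] (mod 4 * m)" for x
    proof
      assume "[x = n + x] (mod 4 * m)"
      then have "[n + x = x] (mod 4 * m)" by (rule cong_sym)
      then show False using n_not_cong_0 by (simp only: cong_add_rcancel_0_nat)
    qed
    have "\<not> [n + (m + n) = n + 3 * m] (mod 4 * m)" "\<not> [n + 3 * m = n + (m + n)] (mod 4 * m)"
      by (simp_all only: cong_add_lcancel_nat generic_noncongruences[OF False] not_False_eq_True)
    note noncong = this mm nn generic_noncongruences(2,3)[OF False]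
    have "b = 0"
      using coeff[of "n + n"] noncong odd_m even_n by (simp add: noncong_parity)
    moreover have "c = 0"
      using coeff[of "n + 3 * m"] noncong odd_m even_n by (simp add: noncong_parity)
    moreover have "d = 0"
      using coeff[of "n + (m + n)"] noncong odd_m even_n by (simp add: noncong_parity)
    ultimately have "g y = a * y" for y by (simp add: g)
    then show thesis by (rule that)
  qed
qed

lemma fixed_by_multiple: "fr k a = a \<Longrightarrow> fr (k * j) a = a"
  by (induction j) (simp_all flip: fr_fr)

lemma fr_even: "fr 2 a = a \<Longrightarrow> even k \<Longrightarrow> fr k a = a"
  by (elim evenE) (simp add: fixed_by_multiple)

lemma fr_odd: "fr 2 a = a \<Longrightarrow> odd k \<Longrightarrow> fr k a = fr 1 a"
proof -
  assume "fr 2 a = a" "odd k"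
  then obtain j where "k = 1 + 2 * j" by (elim oddE) simp
  then have "fr k a = fr 1 (fr (2 * j) a)" by (simp only: fr_fr)
  then show ?thesis using \<open>fr 2 a = a\<close> by (simp add: fixed_by_multiple)
qed

text \<open>
  An element \<open>a\<close> of the subfield of order \<open>q ^ 2\<close> is fixed by \<open>\<sigma>\<close> and \<open>bar\<close>, but \<open>\<tau>\<close> acts on it as
  \<open>fr 1\<close>, since \<open>m\<close> is odd. The right-hand side is symmetric in \<open>x\<close> and \<open>y\<close>, so multiplication by \<open>a\<close>
  can be moved from one factor to the other.
\<close>
lemma bmult_scale_left:
  assumes "fr 2 a = a"
  shows "(a * x) \<star> y = a * P x y - fr 1 a * (v * fr m (Q x y))"
proof -
  have "P (a * x) y = a * P x y"
    using fr_even[OF assms even_n] by (simp add: P_def fr_mult algebra_simps)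
  moreover have "Q (a * x) y = a * Q x y"
    using fr_even[OF assms even_n] fr_even[OF assms, of "2 * m"]
    by (simp add: Q_def fr_mult bar_mult bar_def algebra_simps)
  ultimately show ?thesis
    using fr_odd[OF assms odd_m] by (simp add: bmult_eq fr_mult mult.left_commute)
qed

lemma bmult_central_scale_left:
  assumes "fr 1 a = a"
  shows "(a * x) \<star> y = a * (x \<star> y)"
proof -
  have "fr 2 a = a" using fixed_by_multiple[OF assms, of 2] by simp
  from bmult_scale_left[OF this, of x y] show ?thesis
    unfolding assms by (simp only: bmult_eq right_diff_distrib)
qed

text \<open>
  Setting \<open>y = 1\<close> and comparing the coefficients of \<open>fr 0\<close>, \<open>fr n\<close>, \<open>fr (3 * m)\<close> shows that \<open>a\<close> is fixed
  by \<open>fr (2 * m)\<close> and \<open>fr (2 * n)\<close>, hence by \<open>fr 2\<close>.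
\<close>
lemma middle_pairs_scalars:
  assumes scal: "\<And>x y. (a * x) \<star> y = x \<star> (b * y)"
  shows "fr 2 a = a" and "b = a"
proof -
  let ?ps = "[(0, a - fr n b), (n, fr n a - b), (3 * m, - v * (fr (3 * m) a - fr (m + n) b)),
      (m + n, - v * (fr (m + n) a - fr (3 * m) b))]"
  have coeff: "(\<Sum>(k, c)\<leftarrow>?ps. if [k = r] (mod 4 * m) then c else 0) = 0" for r
  proof (rule coefficient_zero)
    fix x
    show "(\<Sum>(k, c)\<leftarrow>?ps. c * fr k x) = 0"
      using scal[of x 1] by (simp add: bmult_expand fr_mult algebra_simps)
  qed
  have a: "a = fr n b" using coeff[of 0] n_not_cong_0 odd_m even_n by (simp add: noncong_parity)
  have b: "b = fr n a" using coeff[of n] n_not_cong_0 odd_m even_n by (simp add: noncong_parity)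
  have "fr (3 * m) a = fr (m + n) b"
  proof (cases "m = 1 \<and> n = 2")
    case True
    then have e: "m + n = 3 * m" by simp
    have "(- 2 * v) * (fr (3 * m) a - fr (3 * m) b)
        = - v * (fr (3 * m) a - fr (3 * m) b) + - v * (fr (3 * m) a - fr (3 * m) b)"
      by (simp add: algebra_simps)
    also have "\<dots> = 0"
      using coeff[of "3 * m"] odd_m even_n by (simp add: e noncong_parity)
    finally have "(- 2 * v) * (fr (3 * m) a - fr (3 * m) b) = 0" .
    then show ?thesis using two_nonzero v_nonzero by (simp add: e)
  next
    case False
    then show ?thesis
      using coeff[of "3 * m"] odd_m even_n generic_noncongruences(1,4) v_nonzero
      by (simp add: noncong_parity)
  qed
  moreover have "m + 2 * m = 3 * m" by simp
  ultimately have "fr m (fr (2 * m) a) = fr m (fr n b)"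
    by (simp only: fr_fr)
  also have "fr n b = a" by (rule a[symmetric])
  finally have "fr (2 * m) a = a" by simp
  moreover have "fr (2 * n) a = fr n (fr n a)" by (simp add: fr_fr mult_2)
  then have "fr (2 * n) a = a" by (simp only: b[symmetric] a[symmetric])
  ultimately have "fr (gcd (2 * m) (2 * n)) a = a" by (rule fixed_gcd)
  moreover have "gcd (2 * m) (2 * n) = 2"
    using coprime_mn by (simp add: gcd_mult_distrib_nat[symmetric])
  ultimately show "fr 2 a = a" by simp
  then show "b = a" using b fr_even[OF _ even_n, of a] by simp
qed

lemma middle_pairs_bmult:
  "middle_pairs bmult = (\<lambda>a. ((*) a, (*) a)) ` {a. fr 2 a = a}"
proof (intro equalityI subsetI)
  fix p assume p: "p \<in> middle_pairs bmult"
  obtain f g where "p = (f, g)" by fastforce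
  with p have fg: "f x \<star> y = x \<star> g y" for x y by (simp add: middle_pairs_def)
  obtain b where b: "\<And>y. g y = b * y"
    using scalar_if_translates_in_bspan coefficients_in_bspan[OF fg] by blast
  have gf: "g x \<star> y = x \<star> f y" for x y
    using fg[of y x] by (simp add: bmult_commute)
  obtain a where a: "\<And>y. f y = a * y"
    using scalar_if_translates_in_bspan coefficients_in_bspan[OF gf] by blast
  have "(a * x) \<star> y = x \<star> (b * y)" for x y using fg by (simp add: a b)
  from middle_pairs_scalars[OF this] have "fr 2 a = a" "b = a" .
  moreover have "f = (*) a" "g = (*) b" using a b by auto
  ultimately show "p \<in> (\<lambda>a. ((*) a, (*) a)) ` {a. fr 2 a = a}"
    using \<open>p = (f, g)\<close> by blast
next
  fix p :: "('a \<Rightarrow> 'a) \<times> ('a \<Rightarrow> 'a)"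
  assume "p \<in> (\<lambda>a. ((*) a, (*) a)) ` {a. fr 2 a = a}"
  then obtain a where a: "fr 2 a = a" "p = ((*) a, (*) a)" by blast
  have sym: "P y x = P x y" "Q y x = Q x y" for x y
    by (simp_all add: P_def Q_def algebra_simps)
  have "x \<star> (a * y) = (a * x) \<star> y" for x y
    unfolding bmult_commute[of x] bmult_scale_left[OF a(1)] sym[of y x] ..
  then show "p \<in> middle_pairs bmult" by (simp add: middle_pairs_def a(2))
qed

lemma inj_scalars: "inj ((*) :: 'a \<Rightarrow> 'a \<Rightarrow> 'a)"
  by (intro injI) (metis mult.right_neutral)

lemma card_middle_pairs_bmult: "card (middle_pairs bmult) = q ^ 2"
proof -
  have "inj_on (\<lambda>a::'a. ((*) a, (*) a)) X" for X
    using inj_scalars by (auto simp: inj_on_def)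
  then show ?thesis
    unfolding middle_pairs_bmult by (simp add: card_image card_fixed_fr)
qed

lemma bar_u_neq: "bar u \<noteq> u"
proof
  assume "bar u = u"
  with half_power_square[of u] half_power_norm_u show False
    using u_nonzero two_nonzero by (simp add: power2_eq_square eq_neg_iff_add_eq_0)
qed

text \<open>
  Were \<open>a\<close> moved by \<open>fr 1\<close>, then by \<open>bmult_scale_left\<close> the values of \<open>P\<close> and \<open>Q\<close> would be determined
  by the product. Take \<open>x\<close> with \<open>x \<star> 1 = u \<star> u\<close>. The difference \<open>P - Q\<close> is \<open>x - bar x\<close> at \<open>(x, 1)\<close>, hence
  negated by \<open>bar\<close>. At \<open>(u, u)\<close> it is \<open>2 * \<sigma> u * (u - bar u)\<close>, and this is negated by \<open>bar\<close> only if
  \<open>u = bar u\<close>.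
\<close>
lemma central_scalar_fixed:
  assumes a: "fr 2 a = a" and \<gamma>: "\<And>x y. (a * x) \<star> y = \<gamma> (x \<star> y)"
  shows "fr 1 a = a"
proof (rule ccontr)
  assume neq: "fr 1 a \<noteq> a"
  obtain x where x: "x \<star> 1 = u \<star> u"
    using bij_bmult[of 1] by (metis bij_def one_neq_zero surjD)
  have "(a * x) \<star> 1 = (a * u) \<star> u" by (simp add: \<gamma> x)
  then have *: "a * P x 1 - fr 1 a * (v * fr m (Q x 1)) = a * P u u - fr 1 a * (v * fr m (Q u u))"
    by (simp only: bmult_scale_left[OF a])
  have eq: "v * fr m (Q x 1) = v * fr m (Q u u) + (P x 1 - P u u)"
    using x by (simp add: bmult_eq algebra_simps)
  have "(a - fr 1 a) * (P x 1 - P u u) = 0"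
    using * unfolding eq by (simp add: algebra_simps)
  then have PP: "P x 1 = P u u" using neq by simp
  then have QQ: "Q x 1 = Q u u" using eq v_nonzero by simp
  define d where "d = x - bar x"
  have "d = P x 1 - Q x 1" by (simp add: d_def P_def Q_def bar_def)
  then have d: "d = 2 * (fr n u * (u - bar u))"
    unfolding PP QQ by (simp add: P_def Q_def algebra_simps)
  have "bar 2 = 2" using bar_add[of 1 1] by (simp add: bar_def)
  then have "bar d = 2 * (fr n (bar u) * (bar u - u))"
    unfolding d by (simp add: bar_mult bar_diff bar_fr)
  moreover have "bar d = - d" by (simp add: d_def bar_diff)
  ultimately have "2 * (fr n u * (u - bar u)) + 2 * (fr n (bar u) * (bar u - u)) = 0"
    using d by simp
  then have "2 * (fr n (u - bar u) * (u - bar u)) = 0"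
    by (simp add: fr_diff algebra_simps)
  then show False using two_nonzero bar_u_neq by simp
qed

lemma central_triples_bmult:
  "central_triples bmult = (\<lambda>a. ((*) a, (*) a, (*) a)) ` {a. fr 1 a = a}"
proof (intro equalityI subsetI)
  fix p assume p: "p \<in> central_triples bmult"
  obtain f g h where p_eq: "p = (f, g, h)" by (metis prod.exhaust)
  with p have fh: "f x \<star> y = h (x \<star> y)" and gh: "x \<star> g y = h (x \<star> y)" for x y
    by (simp_all add: central_triples_def)
  then have "(f, g) \<in> middle_pairs bmult" by (simp add: middle_pairs_def)
  then obtain a where a: "fr 2 a = a" "f = (*) a" "g = (*) a"
    unfolding middle_pairs_bmult by blast
  have ah: "(a * x) \<star> y = h (x \<star> y)" for x y using fh a(2) by simp
  have fix1: "fr 1 a = a" using central_scalar_fixed[OF a(1)] ah by blast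
  have "h z = a * z" for z
  proof -
    obtain x where "z = x \<star> 1"
      using bij_bmult[of 1] by (metis bij_def one_neq_zero surjD)
    then show ?thesis
      using ah[of x 1] by (simp only: bmult_central_scale_left[OF fix1])
  qed
  then have "h = (*) a" by auto
  then show "p \<in> (\<lambda>a. ((*) a, (*) a, (*) a)) ` {a. fr 1 a = a}"
    using fix1 a p_eq by blast
next
  fix p :: "('a \<Rightarrow> 'a) \<times> ('a \<Rightarrow> 'a) \<times> ('a \<Rightarrow> 'a)"
  assume "p \<in> (\<lambda>a. ((*) a, (*) a, (*) a)) ` {a. fr 1 a = a}"
  then obtain a where a: "fr 1 a = a" "p = ((*) a, (*) a, (*) a)" by blast
  note left = bmult_central_scale_left[OF a(1)]
  then have "x \<star> (a * y) = a * (x \<star> y)" for x y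
    by (simp add: bmult_commute[of x])
  then show "p \<in> central_triples bmult" by (simp add: central_triples_def a(2) left)
qed

lemma card_central_triples_bmult: "card (central_triples bmult) = q"
proof -
  have "inj_on (\<lambda>a::'a. ((*) a, (*) a, (*) a)) X" for X
    using inj_scalars by (auto simp: inj_on_def)
  then show ?thesis
    unfolding central_triples_bmult using card_fixed_fr[of 1] by (simp add: card_image)
qed

end

theorem theorem4p5:
  fixes q m n :: nat
    and u v :: "'a::finite_field"
    and S :: "'b::{ab_group_add,finite} \<Rightarrow> 'b \<Rightarrow> 'b"
  assumes "primepow q" and "odd q"
    and "m \<ge> 1" and "0 < n" and "n < 4 * m"
    and "coprime m n"
    and "odd (2 * m div gcd (2 * m) n)"
    and "[q ^ m = 1] (mod 4)" and "[q ^ n = 1] (mod 4)"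
    and "CARD('a) = q ^ (4 * m)"
    and "primitive_element u" and "v = u ^ (q ^ m - 1)"
  shows "presemifield (bierbrauer_mult q m n v) \<and>
    (semifield S \<and> isotopic (bierbrauer_mult q m n v) S \<longrightarrow>
      card (middle_nucleus S) = q ^ 2 \<and> card (center S) = q)"
proof -
  interpret bierbrauer q m u n v
    using assms by unfold_locales auto
  show ?thesis
    using presemifield_bmult semifield.card_middle_nucleus[of S] semifield.card_center[of S]
      card_middle_pairs_isotopic[of bmult S] card_central_triples_isotopic[of bmult S]
      card_middle_pairs_bmult card_central_triples_bmult
    by simp
qed

end
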